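(* For every bipartite graph $H$ with at most 6 vertices, the class of $(P_7,H)$-free bipartite graphs is at most factorial.
   Context: Graphs are finite, simple and undirected. Every bipartite graph (in particular the forbidden graph $H$) is given together with a bipartition of its vertex set into two independent sets (parts). A bipartite graph $G$ contains a bipartite graph $H$ as an induced subgraph if there is an induced copy of $H$ in $G$ in which the two parts of $H$ are mapped into the two different parts of $G$ (it is not specified which part of $H$ goes to which part of $G$); $G$ is $(P_7,H)$-free if it contains neither $P_7$ nor $H$ as an induced subgraph. $P_7$ is the chordless path with 7 vertices. A hereditary class (one closed under taking induced subgraphs) is at most factorial if the number of labelled graphs in it with vertex set $\{1,\ldots,n\}$ is $2^{O(n\log n)}$. *)

theory Defs
  imports Complex_Main "HOL-Library.Landau_Symbols"
begin

text \<open>A bipartite graph together with its bipartition. The vertex set is the union of the two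
  parts, either of which may be empty; edges are unordered pairs.\<close>

record 'a bigraph =
  left :: "'a set"
  right :: "'a set"
  edges :: "'a set set"

definition verts :: "'a bigraph \<Rightarrow> 'a set" where
  "verts G = left G \<union> right G"

definition bipartite_graph :: "'a bigraph \<Rightarrow> bool" where
  "bipartite_graph G \<longleftrightarrow>
     finite (left G) \<and> finite (right G) \<and> left G \<inter> right G = {} \<and>
     edges G \<subseteq> {{x, y} | x y. x \<in> left G \<and> y \<in> right G}"

definition contains_induced :: "'a bigraph \<Rightarrow> 'b bigraph \<Rightarrow> bool" where
  "contains_induced G H \<longleftrightarrow>
     (\<exists>f. inj_on f (verts H) \<and>
          (f ` left H \<subseteq> left G \<and> f ` right H \<subseteq> right G \<or>
           f ` left H \<subseteq> right G \<and> f ` right H \<subseteq> left G) \<and>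
          (\<forall>x \<in> verts H. \<forall>y \<in> verts H. {f x, f y} \<in> edges G \<longleftrightarrow> {x, y} \<in> edges H))"

text \<open>The chordless path on the vertices \<open>0, \<dots>, k - 1\<close>, with its bipartition by parity.\<close>

definition path_bigraph :: "nat \<Rightarrow> nat bigraph" where
  "path_bigraph k =
     \<lparr>left = {i. i < k \<and> even i}, right = {i. i < k \<and> odd i},
      edges = {{i, Suc i} | i. Suc i < k}\<rparr>"

definition P7_H_free_class :: "'b bigraph \<Rightarrow> 'a bigraph set" where
  "P7_H_free_class H =
     {G. bipartite_graph G \<and> \<not> contains_induced G (path_bigraph 7) \<and> \<not> contains_induced G H}"

text \<open>As \<^const>\<open>contains_induced\<close> allows relabelling, a hereditary class is also closed under
  isomorphism (including exchange of the two parts).\<close>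

definition hereditary :: "'a bigraph set \<Rightarrow> bool" where
  "hereditary X \<longleftrightarrow>
     X \<subseteq> Collect bipartite_graph \<and>
     (\<forall>G \<in> X. \<forall>G'. bipartite_graph G' \<and> contains_induced G G' \<longrightarrow> G' \<in> X)"

text \<open>The labelled graphs of a class are counted together with their bipartitions. Forgetting
  the bipartition changes this number by a factor of at most \<open>2 ^ n\<close>.\<close>

definition labelled_count :: "nat bigraph set \<Rightarrow> nat \<Rightarrow> nat" where
  "labelled_count X n = card {G \<in> X. verts G = {1..n}}"

definition at_most_factorial :: "nat bigraph set \<Rightarrow> bool" where
  "at_most_factorial X \<longleftrightarrow>
     hereditary X \<and>
     (\<exists>g \<in> O(\<lambda>n::nat. real n * ln (real n)). \<forall>n. real (labelled_count X n) \<le> 2 powr g n)"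

end

theory Submission
  imports Defs
begin

text \<open>
  Already the class of all \<open>P\<^sub>7\<close>-free bipartite graphs is at most factorial, and the graphs that
  also avoid \<open>H\<close> are among them. The reason is that a \<open>P\<^sub>7\<close>-free bipartite graph with at least three
  vertices has two vertices on the same side whose neighbourhoods differ in at most 400 vertices
  (\<open>close_vertices\<close>). Deleting one of them and remembering the other together with the difference
  costs a factor \<open>n\<^bsup>O(1)\<^esup>\<close> per deleted vertex, hence \<open>n\<^bsup>O(n)\<^esup>\<close> in total (\<open>card_P7_free_graphs_le\<close>).

  Close vertices come from a packing argument for the neighbourhoods of one side, regarded as a
  family \<open>F\<close> of subsets of the other side \<open>B\<close>. Excluding \<open>P\<^sub>7\<close> makes such a family very thin. If
  both \<open>R\<close> and \<open>insert c R\<close> belong to \<open>F\<close>, call \<open>R\<close> doubled in direction \<open>c\<close>. The sets that are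
  doubled in a fixed direction form a chain (\<open>doubled_chain\<close>), and some direction has at most 12
  of them (\<open>card_doubled_small\<close>): otherwise every direction has a long chain, and inside a gap of
  such a chain there is another one, which spans fewer points (\<open>chain_inside_gap\<close>). Deleting points
  one by one, it follows that \<open>F\<close> has at most \<open>12 * card B + 1\<close> members (\<open>card_path_free_le\<close>), and
  the chain property alone bounds the number of pairs \<open>R\<close>, \<open>insert c R\<close> by \<open>2 * card F\<close>
  (\<open>sum_card_doubled_le\<close>).

  These two linear bounds feed Haussler's packing argument (\<open>packing\<close>): if any two rows differ in
  at least \<open>\<delta>\<close> of the columns \<open>B\<close>, then the number of rows is \<open>O(card B / \<delta>)\<close>. When the rows are
  at least as numerous as the columns, this bounds \<open>\<delta>\<close> by a constant (\<open>close_pair\<close>); one of the two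
  sides of the graph is such a choice of rows.
\<close>

section \<open>Path-free set families\<close>

text \<open>A chordless path on seven vertices alternates between the sides, so as a configuration of
  sets and points it is either three sets separated by four points or four sets on three points.
  Both are excluded: the rows and the columns of a matrix play different roles below.\<close>
definition path_free :: "'b set set \<Rightarrow> bool" where
  "path_free F \<longleftrightarrow>
     (\<forall>X\<in>F. \<forall>Y\<in>F. \<forall>Z\<in>F. \<forall>a b c d.
        \<not> (a \<in> X \<and> a \<notin> Y \<and> a \<notin> Z \<and> b \<in> X \<and> b \<in> Y \<and> b \<notin> Z \<and>
           c \<notin> X \<and> c \<in> Y \<and> c \<in> Z \<and> d \<notin> X \<and> d \<notin> Y \<and> d \<in> Z)) \<and>
     (\<forall>W\<in>F. \<forall>X\<in>F. \<forall>Y\<in>F. \<forall>Z\<in>F. \<forall>a b c.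
        \<not> (a \<in> W \<and> b \<notin> W \<and> c \<notin> W \<and> a \<in> X \<and> b \<in> X \<and> c \<notin> X \<and>
           a \<notin> Y \<and> b \<in> Y \<and> c \<in> Y \<and> a \<notin> Z \<and> b \<notin> Z \<and> c \<in> Z))"

lemma path_freeD3:
  assumes "path_free F" "X \<in> F" "Y \<in> F" "Z \<in> F"
    and "a \<in> X" "a \<notin> Y" "a \<notin> Z" "b \<in> X" "b \<in> Y" "b \<notin> Z"
    and "c \<notin> X" "c \<in> Y" "c \<in> Z" "d \<notin> X" "d \<notin> Y" "d \<in> Z"
  shows False
  using assms unfolding path_free_def by meson

lemma path_freeD4:
  assumes "path_free F" "W \<in> F" "X \<in> F" "Y \<in> F" "Z \<in> F"
    and "a \<in> W" "b \<notin> W" "c \<notin> W" "a \<in> X" "b \<in> X" "c \<notin> X"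
    and "a \<notin> Y" "b \<in> Y" "c \<in> Y" "a \<notin> Z" "b \<notin> Z" "c \<in> Z"
  shows False
  using assms unfolding path_free_def by meson

lemma path_free_mono: "path_free F \<Longrightarrow> G \<subseteq> F \<Longrightarrow> path_free G"
  unfolding path_free_def by (meson subsetD)

lemma path_free_trace:
  assumes "path_free F"
  shows "path_free ((\<lambda>X. X \<inter> S) ` F)"
  unfolding path_free_def
proof (intro conjI ballI allI notI, goal_cases)
  case (1 X Y Z a b c d)
  then obtain X' Y' Z' where "X = X' \<inter> S" "Y = Y' \<inter> S" "Z = Z' \<inter> S" "X' \<in> F" "Y' \<in> F" "Z' \<in> F"
    by blast
  with 1(4) show False
    using path_freeD3[OF assms, of X' Y' Z' a b c d] by blast
next
  case (2 W X Y Z a b c)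
  then obtain W' X' Y' Z'
    where "W = W' \<inter> S" "X = X' \<inter> S" "Y = Y' \<inter> S" "Z = Z' \<inter> S"
      and "W' \<in> F" "X' \<in> F" "Y' \<in> F" "Z' \<in> F"
    by blast
  with 2(5) show False
    using path_freeD4[OF assms, of W' X' Y' Z' a b c] by blast
qed

text \<open>The bipartite complement of \<open>P\<^sub>7\<close> is again \<open>P\<^sub>7\<close>, with its vertices in another order.\<close>
lemma path_free_complement:
  assumes "path_free F"
  shows "path_free ((\<lambda>X. B - X) ` F)"
  unfolding path_free_def
proof (intro conjI ballI allI notI, goal_cases)
  case (1 X Y Z a b c d)
  then obtain X' Y' Z' where "X = B - X'" "Y = B - Y'" "Z = B - Z'" "X' \<in> F" "Y' \<in> F" "Z' \<in> F"
    by blast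
  with 1(4) show False
    using path_freeD3[OF assms, of X' Y' Z' c d a b] by blast
next
  case (2 W X Y Z a b c)
  then obtain W' X' Y' Z'
    where "W = B - W'" "X = B - X'" "Y = B - Y'" "Z = B - Z'"
      and "W' \<in> F" "X' \<in> F" "Y' \<in> F" "Z' \<in> F"
    by blast
  with 2(5) show False
    using path_freeD4[OF assms, of Y' Z' W' X' a b c] by blast
qed

definition doubled :: "'b \<Rightarrow> 'b set set \<Rightarrow> 'b set set" where
  "doubled c F = {R \<in> F. c \<notin> R \<and> insert c R \<in> F}"

lemma doubled_subset: "doubled c F \<subseteq> F"
  by (auto simp: doubled_def)

lemma finite_doubled: "finite F \<Longrightarrow> finite (doubled c F)"
  using doubled_subset by (rule finite_subset)

text \<open>If \<open>d\<close> and \<open>e\<close> witness that \<open>R\<close> and \<open>S\<close> are incomparable, then \<open>R\<close>, \<open>insert c R\<close>, \<open>insert c S\<close>,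
  \<open>S\<close> form a path through the points \<open>d\<close>, \<open>c\<close>, \<open>e\<close>.\<close>
lemma doubled_chain:
  assumes "path_free F" "R \<in> doubled c F" "S \<in> doubled c F"
  shows "R \<subseteq> S \<or> S \<subseteq> R"
proof (rule ccontr)
  assume "\<not> ?thesis"
  then obtain d e where "d \<in> R" "d \<notin> S" "e \<in> S" "e \<notin> R"
    by blast
  show False
    by (rule path_freeD4[OF assms(1), of R "insert c R" "insert c S" S d c e])
      (use \<open>d \<in> R\<close> \<open>d \<notin> S\<close> \<open>e \<in> S\<close> \<open>e \<notin> R\<close> assms(2,3) in \<open>auto simp: doubled_def\<close>)
qed

lemma four_chain:
  assumes fin: "finite C" and chain: "\<And>X Y. X \<in> C \<Longrightarrow> Y \<in> C \<Longrightarrow> X \<subseteq> Y \<or> Y \<subseteq> X"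
    and card: "4 \<le> card C"
  obtains R1 R2 R3 R4 where "R1 \<in> C" "R2 \<in> C" "R3 \<in> C" "R4 \<in> C" "R1 \<subset> R2" "R2 \<subset> R3" "R3 \<subset> R4"
proof -
  have least: "\<exists>R \<in> D. \<forall>S \<in> D - {R}. R \<subset> S" if D: "D \<subseteq> C" "D \<noteq> {}" for D
  proof -
    obtain R where "R \<in> D" and min: "\<forall>S\<in>D. S \<subseteq> R \<longrightarrow> R = S"
      using finite_has_minimal[of D] finite_subset[OF D(1) fin] D(2) by blast
    moreover have "R \<subset> S" if "S \<in> D - {R}" for S
      using chain[of R S] \<open>R \<in> D\<close> D(1) min that by blast
    ultimately show ?thesis
      by blast
  qed
  obtain R1 where R1: "R1 \<in> C" "\<forall>S \<in> C - {R1}. R1 \<subset> S"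
    using least[of C] card by fastforce
  have c1: "card (C - {R1}) = card C - 1"
    using R1 fin by simp
  then have "C - {R1} \<noteq> {}"
    using card by (intro notI) simp
  then obtain R2 where R2: "R2 \<in> C - {R1}" "\<forall>S \<in> C - {R1} - {R2}. R2 \<subset> S"
    using least[of "C - {R1}"] by auto
  have c2: "card (C - {R1} - {R2}) = card C - 2"
    using R2 fin c1 by simp
  then have "C - {R1} - {R2} \<noteq> {}"
    using card by (intro notI) simp
  then obtain R3 where R3: "R3 \<in> C - {R1} - {R2}" "\<forall>S \<in> C - {R1} - {R2} - {R3}. R3 \<subset> S"
    using least[of "C - {R1} - {R2}"] by auto
  have "card (C - {R1} - {R2} - {R3}) = card C - 3"
    using R3 fin c2 by (subst card_Diff_singleton) auto
  then have "C - {R1} - {R2} - {R3} \<noteq> {}"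
    using card by (intro notI) simp
  then obtain R4 where R4: "R4 \<in> C - {R1} - {R2} - {R3}"
    by blast
  show ?thesis
  proof (rule that)
    show "R1 \<subset> R2"
      using R1(2) R2(1) by simp
    show "R2 \<subset> R3"
      using R2(2) R3(1) by simp
    show "R3 \<subset> R4"
      using R3(2) R4 by simp
  qed (use R1(1) R2(1) R3(1) R4 in simp_all)
qed

text \<open>The descent step. Sets doubled in a direction \<open>d\<close> from a gap \<open>R3 - R2\<close> of a chain doubled in
  direction \<open>c\<close> can hardly vary outside of that gap: they all contain \<open>R2 - R1\<close>, they have the
  same trace on \<open>R1\<close>, and outside of \<open>R3\<close> the trace is empty up to some member of the chain and
  constant after it. Of seven such sets, four lie on the same side of this one jump, and those
  differ only within the gap.\<close>
lemma chain_inside_gap: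
  assumes free: "path_free F" and fin: "finite F"
    and R: "R1 \<in> doubled c F" "R2 \<in> doubled c F" "R3 \<in> doubled c F" "R1 \<subset> R2" "R2 \<subset> R3"
    and d: "d \<in> R3 - R2" and C: "C \<subseteq> doubled d F" "\<And>R. R \<in> C \<Longrightarrow> c \<notin> R" "7 \<le> card C"
  obtains S1 S2 S3 S4
  where "S1 \<in> doubled d F" "S2 \<in> doubled d F" "S3 \<in> doubled d F" "S4 \<in> doubled d F"
    and "S1 \<subset> S2" "S2 \<subset> S3" "S3 \<subset> S4" "S4 - S1 \<subseteq> R3 - R2 - {d}"
proof -
  have finC: "finite C"
    using C(1) finite_doubled[OF fin] by (rule finite_subset)
  have R': "R1 \<in> F" "R2 \<in> F" "R3 \<in> F" "insert c R1 \<in> F" "insert c R2 \<in> F" "insert c R3 \<in> F"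
    "c \<notin> R1" "c \<notin> R2" "c \<notin> R3"
    using R by (auto simp: doubled_def)
  have CD: "R \<in> F" "insert d R \<in> F" "d \<notin> R" "c \<notin> R" if "R \<in> C" for R
    using C that by (auto simp: doubled_def)
  have lower: "R2 - R1 \<subseteq> R" if "R \<in> C" for R
  proof (rule ccontr)
    assume "\<not> ?thesis"
    then obtain e where "e \<in> R2" "e \<notin> R1" "e \<notin> R"
      by blast
    show False
      by (rule path_freeD4[OF free, of "insert c R1" "insert c R2" R3 "insert d R" c e d])
        (use \<open>e \<in> R2\<close> \<open>e \<notin> R1\<close> \<open>e \<notin> R\<close> R' CD[OF that] d R(4,5) in auto)
  qed
  have bottom: "R \<inter> R1 \<subseteq> S" if "R \<in> C" "S \<in> C" for R S
  proof (rule ccontr)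
    assume "\<not> ?thesis"
    then obtain b where b: "b \<in> R" "b \<in> R1" "b \<notin> S"
      by blast
    obtain e where e: "e \<in> R2" "e \<notin> R1"
      using R(4) by blast
    then have "e \<in> R" "e \<in> S"
      using lower[OF that(1)] lower[OF that(2)] by blast+
    show False
      by (rule path_freeD3[OF free, of "insert c R1" R "insert d S" c b e d])
        (use b e \<open>e \<in> R\<close> \<open>e \<in> S\<close> R' CD[OF that(1)] CD[OF that(2)] d R(4,5) in auto)
  qed
  have top: "R - R3 = {} \<or> S - R3 \<subseteq> R" if "R \<in> C" "S \<in> C" "R \<subseteq> S" for R S
  proof (rule ccontr)
    assume "\<not> ?thesis"
    then obtain a b where ab: "a \<in> S" "a \<notin> R3" "a \<notin> R" "b \<in> R" "b \<notin> R3"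
      by blast
    show False
      by (rule path_freeD3[OF free, of S "insert d R" "insert c R3" a b d c])
        (use ab R' CD[OF that(1)] CD[OF that(2)] d that(3) in auto)
  qed
  have chain: "X \<subseteq> Y \<or> Y \<subseteq> X" if "X \<in> C" "Y \<in> C" for X Y
    using doubled_chain[OF free] C(1) that by blast
  \<comment> \<open>the two classes are the members of the chain before and after the jump\<close>
  define D where "D = (\<lambda>b. {R \<in> C. (R - R3 = {}) = b})"
  have DC: "D b \<subseteq> C" "finite (D b)" for b
    using finC by (auto simp: D_def)
  have "C = D True \<union> D False" "D True \<inter> D False = {}"
    by (auto simp: D_def)
  then have "card C = card (D True) + card (D False)"
    using DC(2) by (metis card_Un_disjoint)
  then have "4 \<le> card (D True) \<or> 4 \<le> card (D False)"
    using C(3) by linarith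
  then obtain b where b: "4 \<le> card (D b)"
    by blast
  have chain_D: "X \<subseteq> Y \<or> Y \<subseteq> X" if "X \<in> D b" "Y \<in> D b" for X Y
    using chain that DC(1) by blast
  obtain S1 S2 S3 S4
    where S: "S1 \<in> D b" "S2 \<in> D b" "S3 \<in> D b" "S4 \<in> D b" "S1 \<subset> S2" "S2 \<subset> S3" "S3 \<subset> S4"
    by (rule four_chain[OF DC(2) chain_D b])
  have "b \<longleftrightarrow> S1 - R3 = {}" "b \<longleftrightarrow> S4 - R3 = {}"
    using S(1,4) by (simp_all add: D_def)
  have "S1 \<in> C" "S4 \<in> C" "S1 \<subseteq> S4"
    using S DC(1)[of b] by auto
  have "S4 - R3 \<subseteq> S1"
    using top[OF \<open>S1 \<in> C\<close> \<open>S4 \<in> C\<close> \<open>S1 \<subseteq> S4\<close>] \<open>b \<longleftrightarrow> S1 - R3 = {}\<close> \<open>b \<longleftrightarrow> S4 - R3 = {}\<close>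
    by blast
  moreover have "S4 \<inter> R1 \<subseteq> S1" "R2 - R1 \<subseteq> S1" "d \<notin> S4"
    using bottom[OF \<open>S4 \<in> C\<close> \<open>S1 \<in> C\<close>] lower[OF \<open>S1 \<in> C\<close>] CD(3)[OF \<open>S4 \<in> C\<close>] .
  ultimately have "S4 - S1 \<subseteq> R3 - R2 - {d}"
    by blast
  moreover have "D b \<subseteq> doubled d F"
    using DC(1) C(1) by (rule subset_trans)
  ultimately show ?thesis
    using S by (intro that[of S1 S2 S3 S4]) (auto dest: subsetD)
qed

lemma doubled_complement:
  assumes "F \<subseteq> Pow B" "c \<in> B" "R \<in> doubled c F"
  shows "B - insert c R \<in> doubled c ((\<lambda>X. B - X) ` F)"
proof -
  have "insert c (B - insert c R) = B - R" "R \<in> F" "insert c R \<in> F"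
    using assms by (auto simp: doubled_def)
  then show ?thesis
    by (auto simp: doubled_def)
qed

text \<open>The sets doubled in direction \<open>d\<close> may avoid \<open>c\<close> or contain it; thirteen of them guarantee seven
  of one kind. The descent step handles those that avoid \<open>c\<close>; complementation exchanges the two
  kinds and reverses chains. This is why the chain has four members: the step uses the three
  lower ones in the first case and the three upper ones in the second.\<close>
lemma no_doubled_four_chain:
  assumes free: "path_free F" and B: "F \<subseteq> Pow B" "finite B"
    and many: "\<And>c. c \<in> B \<Longrightarrow> 13 \<le> card (doubled c F)"
    and "c \<in> B" "R1 \<in> doubled c F" "R2 \<in> doubled c F" "R3 \<in> doubled c F" "R4 \<in> doubled c F"
    and "R1 \<subset> R2" "R2 \<subset> R3" "R3 \<subset> R4"
  shows False
  using assms(5-12)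
proof (induction "card (R4 - R1)" arbitrary: c R1 R2 R3 R4 rule: less_induct)
  case less
  have finF: "finite F"
    using B by (meson finite_Pow_iff finite_subset)
  have sub: "X \<subseteq> B" if "X \<in> doubled e F" for X e
    using that B(1) by (auto simp: doubled_def)
  have R: "c \<notin> R1" "c \<notin> R2" "c \<notin> R3" "c \<notin> R4"
    using less.prems(2-5) by (auto simp: doubled_def)
  obtain d where d: "d \<in> R3" "d \<notin> R2"
    using less.prems(7) by blast
  have dB: "d \<in> B" and dc: "d \<noteq> c"
    using d sub[OF less.prems(4)] R(3) by auto
  have finR: "finite (R4 - R1)"
    using sub[OF less.prems(5)] B(2) by (meson finite_Diff finite_subset)
  have gap: "card D < card (R4 - R1)" if "D \<subseteq> R3 - R2 - {d}" for D
  proof (rule psubset_card_mono[OF finR])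
    show "D \<subset> R4 - R1"
      using that d less.prems(6,8) by blast
  qed
  define C0 C1 where "C0 = {R \<in> doubled d F. c \<notin> R}" and "C1 = {R \<in> doubled d F. c \<in> R}"
  have "doubled d F = C0 \<union> C1" "C0 \<inter> C1 = {}" "finite C0" "finite C1"
    using finite_doubled[OF finF] by (auto simp: C0_def C1_def)
  then have "13 \<le> card C0 + card C1"
    using many[OF dB] by (metis card_Un_disjoint)
  then consider "7 \<le> card C0" | "7 \<le> card C1"
    by linarith
  then show False
  proof cases
    case 1
    obtain S1 S2 S3 S4
      where S: "S1 \<in> doubled d F" "S2 \<in> doubled d F" "S3 \<in> doubled d F" "S4 \<in> doubled d F"
        "S1 \<subset> S2" "S2 \<subset> S3" "S3 \<subset> S4" and "S4 - S1 \<subseteq> R3 - R2 - {d}"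
      by (rule chain_inside_gap[OF free finF less.prems(2-4,6,7) _ _ _ 1, of d])
        (use d in \<open>auto simp: C0_def\<close>)
    then show False
      using less.hyps[OF gap dB S] by blast
  next
    case 2
    let ?F = "(\<lambda>X. B - X) ` F"
    have FF: "(\<lambda>X. B - X) ` ?F = F"
      using B(1) by (force simp: image_image double_diff)
    have "inj_on (\<lambda>R. B - insert d R) C1"
    proof (rule inj_onI)
      fix X Y
      assume "X \<in> C1" "Y \<in> C1" "B - insert d X = B - insert d Y"
      moreover from this have "d \<notin> X" "d \<notin> Y" "X \<subseteq> B" "Y \<subseteq> B"
        using sub by (auto simp: C1_def doubled_def)
      ultimately show "X = Y"
        by blast
    qed
    then have card: "7 \<le> card ((\<lambda>R. B - insert d R) ` C1)"
      using 2 by (simp add: card_image)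
    have C1': "(\<lambda>R. B - insert d R) ` C1 \<subseteq> doubled d ?F"
      using doubled_complement[OF B(1) dB] by (auto simp: C1_def)
    have R': "B - insert c R4 \<subset> B - insert c R3" "B - insert c R3 \<subset> B - insert c R2"
      using R sub[OF less.prems(5)] less.prems(7,8) by blast+
    have d': "d \<in> B - insert c R2 - (B - insert c R3)"
      using d dB dc by blast
    note comp = doubled_complement[OF B(1) less.prems(1)]
    obtain S1 S2 S3 S4
      where S: "S1 \<in> doubled d ?F" "S2 \<in> doubled d ?F" "S3 \<in> doubled d ?F" "S4 \<in> doubled d ?F"
        "S1 \<subset> S2" "S2 \<subset> S3" "S3 \<subset> S4"
        and gap': "S4 - S1 \<subseteq> B - insert c R2 - (B - insert c R3) - {d}"
      by (rule chain_inside_gap[OF path_free_complement[OF free] _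
            comp[OF less.prems(5)] comp[OF less.prems(4)] comp[OF less.prems(3)] R' d' C1' _ card])
        (use finF in \<open>auto simp: C1_def\<close>)
    have dS: "d \<notin> S1" "d \<notin> S2" "d \<notin> S3" "d \<notin> S4"
      using S(1-4) by (auto simp: doubled_def)
    have SB: "S4 \<subseteq> B"
      using S(4) by (auto simp: doubled_def)
    have "?F \<subseteq> Pow B"
      by blast
    note comp' = doubled_complement[OF this dB, unfolded FF]
    have T: "B - insert d S4 \<subset> B - insert d S3" "B - insert d S3 \<subset> B - insert d S2"
      "B - insert d S2 \<subset> B - insert d S1"
      using dS SB S(5-7) by blast+
    have "(B - insert d S1) - (B - insert d S4) = S4 - S1"
      using dS SB by blast
    moreover have "S4 - S1 \<subseteq> R3 - R2 - {d}"
      using gap' R(3) by blast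
    ultimately have "card ((B - insert d S1) - (B - insert d S4)) < card (R4 - R1)"
      using gap by simp
    then show False
      by (rule less.hyps[OF _ dB comp'[OF S(4)] comp'[OF S(3)] comp'[OF S(2)] comp'[OF S(1)] T])
  qed
qed

lemma card_doubled_small:
  assumes free: "path_free F" and B: "F \<subseteq> Pow B" "finite B" "B \<noteq> {}"
  shows "\<exists>c\<in>B. card (doubled c F) \<le> 12"
proof (rule ccontr)
  assume "\<not> ?thesis"
  then have many: "13 \<le> card (doubled c F)" if "c \<in> B" for c
    using that by (auto simp: not_le)
  obtain c where c: "c \<in> B"
    using B(3) by blast
  have "finite F"
    using B by (meson finite_Pow_iff finite_subset)
  obtain R1 R2 R3 R4
    where R: "R1 \<in> doubled c F" "R2 \<in> doubled c F" "R3 \<in> doubled c F" "R4 \<in> doubled c F"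
      "R1 \<subset> R2" "R2 \<subset> R3" "R3 \<subset> R4"
    by (rule four_chain[OF finite_doubled[OF \<open>finite F\<close>, of c]])
      (use many[OF c] doubled_chain[OF free] in auto)
  show False
    by (rule no_doubled_four_chain[OF free B(1,2) many c R])
qed

text \<open>Deleting the point \<open>c\<close> identifies exactly the pairs \<open>R\<close>, \<open>insert c R\<close>.\<close>
lemma card_remove_point:
  assumes "finite F"
  shows "card F = card ((\<lambda>X. X - {c}) ` F) + card (doubled c F)"
proof -
  let ?D = "insert c ` doubled c F"
  have "inj_on (insert c) (doubled c F)"
    by (rule inj_onI) (auto simp: doubled_def)
  then have D: "card ?D = card (doubled c F)"
    by (rule card_image)
  have "inj_on (\<lambda>X. X - {c}) (F - ?D)"
  proof (rule inj_onI, rule ccontr)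
    fix X Y
    assume XY: "X \<in> F - ?D" "Y \<in> F - ?D" "X - {c} = Y - {c}" "X \<noteq> Y"
    then consider "c \<in> X" "c \<notin> Y" | "c \<notin> X" "c \<in> Y"
      by blast
    then show False
    proof cases
      case 1
      then have "X = insert c Y"
        using XY(3) by blast
      with XY(1,2) 1 show False
        by (auto simp: doubled_def)
    next
      case 2
      then have "Y = insert c X"
        using XY(3) by blast
      with XY(1,2) 2 show False
        by (auto simp: doubled_def)
    qed
  qed
  then have "card ((\<lambda>X. X - {c}) ` (F - ?D)) = card (F - ?D)"
    by (rule card_image)
  moreover have "(\<lambda>X. X - {c}) ` (F - ?D) = (\<lambda>X. X - {c}) ` F"
  proof
    show "(\<lambda>X. X - {c}) ` F \<subseteq> (\<lambda>X. X - {c}) ` (F - ?D)"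
    proof
      fix T
      assume "T \<in> (\<lambda>X. X - {c}) ` F"
      then obtain X where X: "X \<in> F" "T = X - {c}"
        by blast
      show "T \<in> (\<lambda>X. X - {c}) ` (F - ?D)"
      proof (cases "X \<in> ?D")
        case True
        then have "X - {c} \<in> F - ?D"
          by (auto simp: doubled_def)
        then show ?thesis
          using X(2) by (intro image_eqI[of _ _ "X - {c}"]) auto
      next
        case False
        with X show ?thesis
          by blast
      qed
    qed
  qed blast
  moreover have "card (F - ?D) + card ?D = card F"
  proof -
    have "?D \<subseteq> F"
      by (auto simp: doubled_def)
    then show ?thesis
      using assms by (metis add.commute card_Diff_subset card_mono finite_subset le_add_diff_inverse)
  qed
  ultimately show ?thesis
    using D by simp
qed

lemma path_free_remove: "path_free F \<Longrightarrow> path_free ((\<lambda>X. X - {c}) ` F)"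
  using path_free_trace[of F "- {c}"] by (simp add: Diff_eq)

lemma card_path_free_le:
  assumes "finite B" "path_free F" "F \<subseteq> Pow B"
  shows "card F \<le> 12 * card B + 1"
  using assms
proof (induction "card B" arbitrary: B F)
  case 0
  then have "F \<subseteq> {{}}"
    by auto
  then show ?case
    using card_mono[of "{{}}" F] by simp
next
  case (Suc n)
  then have "B \<noteq> {}"
    by auto
  then obtain c where c: "c \<in> B" "card (doubled c F) \<le> 12"
    using card_doubled_small Suc.prems by blast
  have "card ((\<lambda>X. X - {c}) ` F) \<le> 12 * card (B - {c}) + 1"
    by (rule Suc.hyps(1)) (use Suc c path_free_remove in auto)
  moreover have "finite F"
    using Suc.prems by (meson finite_Pow_iff finite_subset)
  ultimately show ?case
    using card_remove_point[of F c] c Suc.prems(1) Suc.hyps(2) by (simp add: card_Diff_singleton)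
qed

text \<open>A member of a chain has at most one successor with exactly one more point.\<close>
lemma sum_card_doubled_chain:
  assumes "finite B" "finite F" "\<And>X Y. X \<in> F \<Longrightarrow> Y \<in> F \<Longrightarrow> X \<subseteq> Y \<or> Y \<subseteq> X"
  shows "(\<Sum>c\<in>B. card (doubled c F)) \<le> card F"
proof -
  have "doubled c F \<inter> doubled d F = {}" if "c \<noteq> d" for c d
  proof (rule ccontr)
    assume "doubled c F \<inter> doubled d F \<noteq> {}"
    then obtain X where "c \<notin> X" "d \<notin> X" "insert c X \<in> F" "insert d X \<in> F"
      by (auto simp: doubled_def)
    then show False
      using assms(3)[of "insert c X" "insert d X"] that by blast
  qed
  then have "(\<Sum>c\<in>B. card (doubled c F)) = card (\<Union>c\<in>B. doubled c F)"
    using assms finite_doubled by (intro card_UN_disjoint[symmetric]) auto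
  also have "\<dots> \<le> card F"
    using assms(2) by (intro card_mono) (auto simp: doubled_def)
  finally show ?thesis .
qed

text \<open>The left-hand side counts the edges of the unit distance graph of \<open>F\<close>. When \<open>c\<close> is deleted,
  the edges in direction \<open>c\<close> disappear, and two edges in another direction \<open>d\<close> are identified only
  if they come from an edge among the sets doubled in direction \<open>c\<close>. Those form a chain, so the
  total loss is at most twice the number of members lost.\<close>
lemma sum_card_doubled_le:
  assumes "finite B" "path_free F" "F \<subseteq> Pow B"
  shows "(\<Sum>c\<in>B. card (doubled c F)) \<le> 2 * card F"
  using assms
proof (induction "card B" arbitrary: B F)
  case 0
  then show ?case
    by simp
next
  case (Suc n)
  then obtain c where c: "c \<in> B"
    by fastforce
  let ?F = "(\<lambda>X. X - {c}) ` F"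
  have finF: "finite F"
    using Suc.prems by (meson finite_Pow_iff finite_subset)
  have step: "card (doubled d F) \<le> card (doubled d ?F) + card (doubled d (doubled c F))"
    if "d \<in> B - {c}" for d
  proof -
    have dc: "d \<noteq> c"
      using that by blast
    have "(\<lambda>X. X - {c}) ` doubled d F \<subseteq> doubled d ?F"
    proof
      fix T
      assume "T \<in> (\<lambda>X. X - {c}) ` doubled d F"
      then obtain X where X: "X \<in> F" "d \<notin> X" "insert d X \<in> F" "T = X - {c}"
        by (auto simp: doubled_def)
      then have "insert d T = insert d X - {c}" "d \<notin> T"
        using dc by auto
      with X show "T \<in> doubled d ?F"
        unfolding doubled_def by blast
    qed
    then have "card ((\<lambda>X. X - {c}) ` doubled d F) \<le> card (doubled d ?F)"
      using finF by (intro card_mono finite_doubled) auto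
    moreover have "card (doubled c (doubled d F)) = card (doubled d (doubled c F))"
      by (rule arg_cong[of _ _ card]) (use dc in \<open>auto simp: doubled_def insert_commute\<close>)
    ultimately show ?thesis
      using card_remove_point[OF finite_doubled[OF finF], of d c] by simp
  qed
  have "(\<Sum>d\<in>B - {c}. card (doubled d F))
      \<le> (\<Sum>d\<in>B - {c}. card (doubled d ?F)) + (\<Sum>d\<in>B - {c}. card (doubled d (doubled c F)))"
    unfolding sum.distrib[symmetric] by (intro sum_mono step)
  also have "(\<Sum>d\<in>B - {c}. card (doubled d ?F)) \<le> 2 * card ?F"
    by (rule Suc.hyps(1)) (use Suc c path_free_remove in auto)
  also have "(\<Sum>d\<in>B - {c}. card (doubled d (doubled c F))) \<le> card (doubled c F)"
    using Suc.prems finF by (intro sum_card_doubled_chain finite_doubled doubled_chain) auto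
  finally have "(\<Sum>d\<in>B - {c}. card (doubled d F)) \<le> 2 * card ?F + card (doubled c F)"
    by simp
  moreover have "(\<Sum>d\<in>B. card (doubled d F)) = card (doubled c F) + (\<Sum>d\<in>B - {c}. card (doubled d F))"
    using c Suc.prems(1) by (simp add: sum.remove)
  ultimately show ?case
    using card_remove_point[OF finF, of c] by simp
qed

section \<open>Packing\<close>

text \<open>The rows \<open>A\<close> fall into classes according to their traces on \<open>S\<close>, and a new column \<open>c\<close> splits
  each class in two. The smaller parts are counted: their total is small on average because the
  unit distance graph of the traces is sparse, and large on average if the rows are far apart.\<close>
definition split_weight :: "('a \<Rightarrow> 'b set) \<Rightarrow> 'a set \<Rightarrow> 'b set \<Rightarrow> 'b \<Rightarrow> nat" where
  "split_weight N A S c =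
     (\<Sum>T\<in>(\<lambda>r. N r \<inter> S) ` A.
        min (card {r \<in> A. N r \<inter> S = T \<and> c \<notin> N r}) (card {r \<in> A. N r \<inter> S = T \<and> c \<in> N r}))"

lemma sum_card_fibres:
  assumes "finite A" "finite I" "f ` A \<subseteq> I"
  shows "(\<Sum>i\<in>I. card {r \<in> A. f r = i}) = card A"
  using sum.group[OF assms, of "\<lambda>_. 1::nat"] by simp

text \<open>Writing a sum as the sum of the sizes of its level sets turns the bound on the number of edges
  into a bound on the sum of edge weights, where an edge weighs as much as its lighter end.\<close>
lemma sum_levels:
  fixes f :: "'a \<Rightarrow> nat"
  assumes "finite I" "\<And>i. i \<in> I \<Longrightarrow> f i \<le> n"
  shows "(\<Sum>i\<in>I. f i) = (\<Sum>t=1..n. card {i \<in> I. t \<le> f i})"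
proof -
  have "(\<Sum>t=1..n. card {i \<in> I. t \<le> f i}) = (\<Sum>t=1..n. \<Sum>i\<in>I. if t \<le> f i then 1 else 0)"
    using assms(1) by (simp add: sum.If_cases Int_def)
  also have "\<dots> = (\<Sum>i\<in>I. \<Sum>t=1..n. if t \<le> f i then 1 else 0)"
    by (rule sum.swap)
  also have "\<dots> = (\<Sum>i\<in>I. f i)"
  proof (rule sum.cong[OF refl])
    fix i
    assume "i \<in> I"
    then have "{1..n} \<inter> {t. t \<le> f i} = {1..f i}"
      using assms(2)[of i] by auto
    then show "(\<Sum>t=1..n. if t \<le> f i then 1 else 0) = f i"
      by (simp add: sum.If_cases)
  qed
  finally show ?thesis
    by simp
qed

lemma sum_split_weight_le:
  assumes fin: "finite A" "finite S" and free: "path_free (N ` A)"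
  shows "(\<Sum>c\<in>S. split_weight N A (S - {c}) c) \<le> 2 * card A"
proof -
  define w where "w T = card {r \<in> A. N r \<inter> S = T}" for T
  define F where "F t = {T \<in> Pow S. t \<le> w T}" for t
  have w_le: "w T \<le> card A" for T
    unfolding w_def using fin(1) by (intro card_mono) auto
  have finF: "finite (F t)" for t
    using fin(2) by (simp add: F_def)
  have freeF: "path_free (F t)" if "1 \<le> t" for t
  proof (rule path_free_mono[OF path_free_trace[OF free, of S]])
    show "F t \<subseteq> (\<lambda>X. X \<inter> S) ` N ` A"
    proof
      fix T
      assume "T \<in> F t"
      then have "w T \<noteq> 0"
        using that by (auto simp: F_def)
      then have "{r \<in> A. N r \<inter> S = T} \<noteq> {}"
        unfolding w_def by (metis card.empty)
      then show "T \<in> (\<lambda>X. X \<inter> S) ` N ` A"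
        by blast
    qed
  qed
  have layer: "split_weight N A (S - {c}) c \<le> (\<Sum>t=1..card A. card (doubled c (F t)))" if "c \<in> S" for c
  proof -
    let ?I = "(\<lambda>r. N r \<inter> (S - {c})) ` A"
    have min_eq: "min (card {r \<in> A. N r \<inter> (S - {c}) = T \<and> c \<notin> N r})
        (card {r \<in> A. N r \<inter> (S - {c}) = T \<and> c \<in> N r}) = min (w T) (w (insert c T))"
      if "T \<in> ?I" for T
    proof -
      have "c \<notin> T"
        using that by auto
      then have "{r \<in> A. N r \<inter> (S - {c}) = T \<and> c \<notin> N r} = {r \<in> A. N r \<inter> S = T}"
        "{r \<in> A. N r \<inter> (S - {c}) = T \<and> c \<in> N r} = {r \<in> A. N r \<inter> S = insert c T}"
        using \<open>c \<in> S\<close> by blast+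
      then show ?thesis
        by (simp add: w_def)
    qed
    have "split_weight N A (S - {c}) c = (\<Sum>T\<in>?I. min (w T) (w (insert c T)))"
      unfolding split_weight_def by (rule sum.cong[OF refl min_eq])
    also have "\<dots> = (\<Sum>t=1..card A. card {T \<in> ?I. t \<le> min (w T) (w (insert c T))})"
      using fin(1) w_le by (intro sum_levels) (auto simp: min_le_iff_disj)
    also have "\<dots> \<le> (\<Sum>t=1..card A. card (doubled c (F t)))"
      using \<open>c \<in> S\<close> finF by (intro sum_mono card_mono finite_doubled) (auto simp: doubled_def F_def)
    finally show ?thesis .
  qed
  have "(\<Sum>c\<in>S. split_weight N A (S - {c}) c) \<le> (\<Sum>c\<in>S. \<Sum>t=1..card A. card (doubled c (F t)))"
    by (intro sum_mono layer)
  also have "\<dots> = (\<Sum>t=1..card A. \<Sum>c\<in>S. card (doubled c (F t)))"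
    by (rule sum.swap)
  also have "\<dots> \<le> (\<Sum>t=1..card A. 2 * card (F t))"
    using fin(2) freeF by (intro sum_mono sum_card_doubled_le) (auto simp: F_def)
  also have "\<dots> = 2 * (\<Sum>T\<in>Pow S. w T)"
    using fin(2) w_le by (subst sum_levels[of _ _ "card A"]) (auto simp: F_def sum_distrib_left)
  also have "(\<Sum>T\<in>Pow S. w T) = card A"
    unfolding w_def using fin by (intro sum_card_fibres) auto
  finally show ?thesis .
qed

text \<open>Double counting of the triples \<open>(r, s, c)\<close> with \<open>c \<in> N r - N s\<close>: a column that splits \<open>K\<close> into parts
  of sizes \<open>p\<close> and \<open>q\<close> separates \<open>p * q \<le> card K * min p q\<close> pairs.\<close>
lemma pairs_le_split:
  assumes fin: "finite K" "finite C" and diff: "\<And>r s. r \<in> K \<Longrightarrow> s \<in> K \<Longrightarrow> N r - N s \<subseteq> C"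
    and sep: "\<And>r s. r \<in> K \<Longrightarrow> s \<in> K \<Longrightarrow> r \<noteq> s \<Longrightarrow> \<delta> \<le> card (N r - N s) + card (N s - N r)"
  shows "\<delta> * card K \<le> 2 * (\<Sum>c\<in>C. min (card {r \<in> K. c \<notin> N r}) (card {r \<in> K. c \<in> N r})) + \<delta>"
proof (cases "K = {}")
  case False
  let ?m = "\<lambda>c. min (card {r \<in> K. c \<notin> N r}) (card {r \<in> K. c \<in> N r})"
  have finN: "finite (N r - N s)" if "r \<in> K" "s \<in> K" for r s
    using diff[OF that] fin(2) by (rule finite_subset)
  have "\<delta> * (card K * card K) \<le> (\<Sum>r\<in>K. \<Sum>s\<in>K. card (N r - N s) + card (N s - N r)) + \<delta> * card K"
  proof -
    have "(\<Sum>r\<in>K. \<Sum>s\<in>K. \<delta>)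
        \<le> (\<Sum>r\<in>K. \<Sum>s\<in>K. card (N r - N s) + card (N s - N r) + (if s = r then \<delta> else 0))"
      using sep by (intro sum_mono) auto
    then show ?thesis
      using fin(1) by (simp add: sum.distrib mult.commute mult.left_commute)
  qed
  also have "(\<Sum>r\<in>K. \<Sum>s\<in>K. card (N r - N s) + card (N s - N r)) = 2 * (\<Sum>r\<in>K. \<Sum>s\<in>K. card (N r - N s))"
    using sum.swap[of "\<lambda>r s. card (N s - N r)" K K] by (simp add: sum.distrib)
  also have "(\<Sum>r\<in>K. \<Sum>s\<in>K. card (N r - N s)) = (\<Sum>r\<in>K. \<Sum>s\<in>K. \<Sum>c\<in>C. if c \<in> N r \<and> c \<notin> N s then 1 else 0)"
  proof (intro sum.cong refl)
    fix r s
    assume "r \<in> K" "s \<in> K"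
    then have "C \<inter> {c. c \<in> N r \<and> c \<notin> N s} = N r - N s"
      using diff by blast
    then show "card (N r - N s) = (\<Sum>c\<in>C. if c \<in> N r \<and> c \<notin> N s then 1 else 0)"
      using fin(2) by (simp add: sum.If_cases)
  qed
  also have "\<dots> = (\<Sum>c\<in>C. \<Sum>r\<in>K. \<Sum>s\<in>K. if c \<in> N r \<and> c \<notin> N s then 1 else 0)"
    by (subst sum.swap[of _ C], subst sum.swap[of _ C]) (rule refl)
  also have "\<dots> = (\<Sum>c\<in>C. card {r \<in> K. c \<in> N r} * card {r \<in> K. c \<notin> N r})"
  proof (intro sum.cong refl)
    fix c
    have "(\<Sum>r\<in>K. \<Sum>s\<in>K. if c \<in> N r \<and> c \<notin> N s then 1 else 0)
        = (\<Sum>r\<in>K. \<Sum>s\<in>K. (if c \<in> N r then 1 else 0) * (if c \<notin> N s then 1 else (0::nat)))"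
      by (intro sum.cong refl) auto
    also have "\<dots> = (\<Sum>r\<in>K. if c \<in> N r then 1 else 0) * (\<Sum>s\<in>K. if c \<notin> N s then 1 else 0)"
      by (rule sum_product[symmetric])
    also have "\<dots> = card {r \<in> K. c \<in> N r} * card {r \<in> K. c \<notin> N r}"
      using fin(1) by (simp add: sum.If_cases Int_def)
    finally show "(\<Sum>r\<in>K. \<Sum>s\<in>K. if c \<in> N r \<and> c \<notin> N s then 1 else 0)
        = card {r \<in> K. c \<in> N r} * card {r \<in> K. c \<notin> N r}" .
  qed
  also have "\<dots> \<le> (\<Sum>c\<in>C. card K * ?m c)"
  proof (intro sum_mono)
    fix c
    have "card {r \<in> K. c \<in> N r} \<le> card K" "card {r \<in> K. c \<notin> N r} \<le> card K"
      using fin(1) by (auto intro: card_mono)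
    then show "card {r \<in> K. c \<in> N r} * card {r \<in> K. c \<notin> N r} \<le> card K * ?m c"
      by (auto simp: min_def mult.commute[of "card {r \<in> K. c \<in> N r}"] intro: mult_mono)
  qed
  also have "\<dots> = card K * (\<Sum>c\<in>C. ?m c)"
    by (rule sum_distrib_left[symmetric])
  finally have "card K * (\<delta> * card K) \<le> card K * (2 * (\<Sum>c\<in>C. ?m c) + \<delta>)"
    by (simp add: algebra_simps)
  then show ?thesis
    using False fin(1) by (simp add: card_gt_0_iff)
qed simp

lemma split_weight_ge:
  assumes fin: "finite A" "finite B" and B: "N ` A \<subseteq> Pow B" and "S \<subseteq> B"
    and sep: "\<And>r s. r \<in> A \<Longrightarrow> s \<in> A \<Longrightarrow> r \<noteq> s \<Longrightarrow> \<delta> \<le> card (N r - N s) + card (N s - N r)"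
  shows "\<delta> * card A \<le> 2 * (\<Sum>c\<in>B - S. split_weight N A S c) + \<delta> * card ((\<lambda>r. N r \<inter> S) ` A)"
proof -
  let ?I = "(\<lambda>r. N r \<inter> S) ` A"
  let ?K = "\<lambda>T. {r \<in> A. N r \<inter> S = T}"
  let ?m = "\<lambda>T c. min (card {r \<in> A. N r \<inter> S = T \<and> c \<notin> N r}) (card {r \<in> A. N r \<inter> S = T \<and> c \<in> N r})"
  have "\<delta> * card A = (\<Sum>T\<in>?I. \<delta> * card (?K T))"
    using sum_card_fibres[OF fin(1) finite_imageI[OF fin(1)], of "\<lambda>r. N r \<inter> S" "\<lambda>r. N r \<inter> S"]
    by (simp add: sum_distrib_left[symmetric])
  also have "\<dots> \<le> (\<Sum>T\<in>?I. 2 * (\<Sum>c\<in>B - S. ?m T c) + \<delta>)"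
  proof (rule sum_mono)
    fix T
    have "\<delta> * card (?K T) \<le> 2 * (\<Sum>c\<in>B - S. min (card {r \<in> ?K T. c \<notin> N r}) (card {r \<in> ?K T. c \<in> N r})) + \<delta>"
      using fin B sep by (intro pairs_le_split) auto
    then show "\<delta> * card (?K T) \<le> 2 * (\<Sum>c\<in>B - S. ?m T c) + \<delta>"
      by (simp add: conj_assoc)
  qed
  also have "\<dots> = 2 * (\<Sum>T\<in>?I. \<Sum>c\<in>B - S. ?m T c) + \<delta> * card ?I"
    by (simp add: sum.distrib sum_distrib_left)
  also have "(\<Sum>T\<in>?I. \<Sum>c\<in>B - S. ?m T c) = (\<Sum>c\<in>B - S. split_weight N A S c)"
    unfolding split_weight_def by (rule sum.swap)
  finally show ?thesis .
qed

lemma sum_subsets_remove: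
  fixes f :: "'b set \<Rightarrow> 'b \<Rightarrow> nat"
  assumes "finite B"
  shows "(\<Sum>S | S \<subseteq> B \<and> card S = Suc s. \<Sum>c\<in>S. f (S - {c}) c)
    = (\<Sum>S | S \<subseteq> B \<and> card S = s. \<Sum>c\<in>B - S. f S c)"
proof -
  have fin: "finite {S. S \<subseteq> B \<and> P S}" for P
    using assms by simp
  have fin': "\<And>S. S \<subseteq> B \<Longrightarrow> finite S"
    using assms finite_subset by blast
  have "(\<Sum>S | S \<subseteq> B \<and> card S = Suc s. \<Sum>c\<in>S. f (S - {c}) c)
      = (\<Sum>(S, c)\<in>(SIGMA S:{S. S \<subseteq> B \<and> card S = Suc s}. S). f (S - {c}) c)"
    using fin fin' by (subst sum.Sigma) auto
  also have "\<dots> = (\<Sum>(S, c)\<in>(SIGMA S:{S. S \<subseteq> B \<and> card S = s}. B - S). f S c)"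
    by (rule sum.reindex_bij_witness[of _ "\<lambda>(S, c). (insert c S, c)" "\<lambda>(S, c). (S - {c}, c)"])
      (use fin' in \<open>auto simp: insert_absorb card_Diff_singleton card_insert_disjoint\<close>)
  also have "\<dots> = (\<Sum>S | S \<subseteq> B \<and> card S = s. \<Sum>c\<in>B - S. f S c)"
    using fin assms by (subst sum.Sigma) auto
  finally show ?thesis .
qed

text \<open>Haussler's argument, averaging \<open>split_weight\<close> over all sets \<open>S\<close> of \<open>s\<close> columns and all further
  columns. From above, each set of \<open>Suc s\<close> columns contributes at most \<open>2 * card A\<close>. From below, each
  \<open>S\<close> contributes at least \<open>\<delta> / 2\<close> times the number of rows minus the number of traces on \<open>S\<close>, which
  is at most \<open>12 * s + 1\<close>. The ratio \<open>card B / s\<close> of the numbers of sets then forces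
  \<open>\<delta> = O(card B / s)\<close> as long as \<open>24 * s\<close> is at most the number of rows.\<close>
lemma packing:
  assumes fin: "finite A" "finite B" and B: "N ` A \<subseteq> Pow B" and free: "path_free (N ` A)"
    and sep: "\<And>r s. r \<in> A \<Longrightarrow> s \<in> A \<Longrightarrow> r \<noteq> s \<Longrightarrow> \<delta> \<le> card (N r - N s) + card (N s - N r)"
    and s: "s \<le> card B"
  shows "\<delta> * card A * Suc s \<le> 4 * card A * card B + \<delta> * (12 * s + 1) * Suc s"
proof -
  let ?b = "card B"
  define W where "W = (\<Sum>S | S \<subseteq> B \<and> card S = s. \<Sum>c\<in>B - S. split_weight N A S c)"
  have "W = (\<Sum>S | S \<subseteq> B \<and> card S = Suc s. \<Sum>c\<in>S. split_weight N A (S - {c}) c)"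
    unfolding W_def using sum_subsets_remove[OF fin(2), symmetric] .
  also have "\<dots> \<le> (\<Sum>S | S \<subseteq> B \<and> card S = Suc s. 2 * card A)"
    using fin finite_subset[OF _ fin(2)] free by (intro sum_mono sum_split_weight_le) auto
  also have "\<dots> = (?b choose Suc s) * (2 * card A)"
    using fin(2) by (simp add: n_subsets)
  finally have upper: "W \<le> (?b choose Suc s) * (2 * card A)" .
  have "(\<Sum>S | S \<subseteq> B \<and> card S = s. \<delta> * card A)
      \<le> (\<Sum>S | S \<subseteq> B \<and> card S = s. 2 * (\<Sum>c\<in>B - S. split_weight N A S c) + \<delta> * (12 * s + 1))"
  proof (rule sum_mono)
    fix S
    assume "S \<in> {S. S \<subseteq> B \<and> card S = s}"
    then have S: "S \<subseteq> B" "card S = s"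
      by auto
    have "(\<lambda>r. N r \<inter> S) ` A = (\<lambda>X. X \<inter> S) ` N ` A"
      by (simp add: image_image)
    then have "card ((\<lambda>r. N r \<inter> S) ` A) \<le> 12 * s + 1"
      using card_path_free_le[of S "(\<lambda>X. X \<inter> S) ` N ` A"] S finite_subset[OF S(1) fin(2)]
        path_free_trace[OF free] by auto
    then have "\<delta> * card ((\<lambda>r. N r \<inter> S) ` A) \<le> \<delta> * (12 * s + 1)"
      by (rule mult_le_mono2)
    then show "\<delta> * card A \<le> 2 * (\<Sum>c\<in>B - S. split_weight N A S c) + \<delta> * (12 * s + 1)"
      using split_weight_ge[OF fin B S(1) sep] by linarith
  qed
  also have "\<dots> = 2 * W + (?b choose s) * (\<delta> * (12 * s + 1))"
    unfolding W_def using fin(2) by (simp add: sum.distrib sum_distrib_left n_subsets)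
  finally have "(?b choose s) * (\<delta> * card A)
      \<le> 2 * ((?b choose Suc s) * (2 * card A)) + (?b choose s) * (\<delta> * (12 * s + 1))"
    using upper fin(2) by (simp add: n_subsets)
  then have "(?b choose s) * (\<delta> * card A) * Suc s
      \<le> (2 * ((?b choose Suc s) * (2 * card A)) + (?b choose s) * (\<delta> * (12 * s + 1))) * Suc s"
    by (rule mult_le_mono1)
  also have "\<dots> = 4 * card A * (Suc s * (?b choose Suc s)) + (?b choose s) * (\<delta> * (12 * s + 1) * Suc s)"
    by (simp add: algebra_simps)
  also have "Suc s * (?b choose Suc s) \<le> ?b * (?b choose s)"
    using binomial_absorb_comp[of ?b s] Suc_times_binomial_eq[of "?b" s] by (simp add: binomial_absorption)
  finally have "(?b choose s) * (\<delta> * card A * Suc s)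
      \<le> (?b choose s) * (4 * card A * ?b + \<delta> * (12 * s + 1) * Suc s)"
    by (simp add: algebra_simps)
  then show ?thesis
    using s by (simp add: zero_less_binomial)
qed

text \<open>If the rows are far apart, they are distinct, so their number is at most \<open>12 * card B + 1\<close> and a
  sample of \<open>card A div 24\<close> columns exists. For this sample, \<open>packing\<close> bounds the distance by a
  multiple of \<open>card B / card A\<close>, except when there are very few rows.\<close>
lemma close_pair:
  assumes fin: "finite A" "finite B" and B: "N ` A \<subseteq> Pow B" and free: "path_free (N ` A)"
    and card: "card B \<le> card A" "2 \<le> card A"
  shows "\<exists>r\<in>A. \<exists>s\<in>A. r \<noteq> s \<and> card ((N r - N s) \<union> (N s - N r)) \<le> 400"
proof (rule ccontr)
  assume "\<not> ?thesis"
  then have sep: "401 \<le> card (N r - N s) + card (N s - N r)" if "r \<in> A" "s \<in> A" "r \<noteq> s" for r s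
  proof -
    have "400 < card ((N r - N s) \<union> (N s - N r))"
      using \<open>\<not> (\<exists>r\<in>A. _ r)\<close> that by (meson not_le)
    also have "\<dots> \<le> card (N r - N s) + card (N s - N r)"
      by (rule card_Un_le)
    finally show ?thesis
      by simp
  qed
  have "inj_on N A"
    using sep by (intro inj_onI) fastforce
  then have ab: "card A \<le> 12 * card B + 1"
    using card_path_free_le[OF fin(2) free B] by (simp add: card_image)
  \<comment> \<open>the largest sample for which at most about half of the rows can have distinct traces\<close>
  define s q where "s = card A div 24" and "q = Suc s"
  have sq: "24 * s \<le> card A" "card A < 24 * q"
    unfolding s_def q_def by presburger+
  have "s \<le> card B"
    using ab card(2) unfolding s_def by linarith
  then have "401 * card A * q \<le> 4 * card A * card B + 401 * (12 * s + 1) * q"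
    unfolding q_def using packing[OF fin B free sep] by blast
  then have "401 * (card A * q) \<le> 4 * (card A * card B) + 4812 * (s * q) + 401 * q"
    by (simp add: algebra_simps)
  moreover have "card A * card B \<le> 24 * (card A * q)"
    using mult_le_mono2[of "card B" "24 * q" "card A"] card(1) sq(2) by (simp only: mult.left_commute)
  moreover have "24 * (s * q) \<le> card A * q"
    using mult_le_mono1[OF sq(1), of q] by (simp only: mult.assoc)
  ultimately have "209 * (card A * q) \<le> 802 * q"
    by linarith
  then have "q * (209 * card A) \<le> q * 802"
    by (simp add: algebra_simps)
  then have "209 * card A \<le> 802"
    by (subst (asm) mult_le_cancel1) (simp add: q_def)
  then have "card B \<le> 3"
    using card(1) by simp
  obtain r s where rs: "r \<in> A" "s \<in> A" "r \<noteq> s"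
    using card(2) fin(1) by (metis card_le_Suc0_iff_eq not_less_eq_eq numeral_2_eq_2)
  then have "N r - N s \<subseteq> B" "N s - N r \<subseteq> B"
    using B by blast+
  then have "card (N r - N s) \<le> 3" "card (N s - N r) \<le> 3"
    using \<open>card B \<le> 3\<close> fin(2) by (meson card_mono order_trans)+
  then show False
    using sep[OF rs] by simp
qed

section \<open>Bipartite graphs\<close>

definition nbrs :: "'a bigraph \<Rightarrow> 'a \<Rightarrow> 'a set" where
  "nbrs G x = {y. {x, y} \<in> edges G}"

lemma nbrs_sym: "y \<in> nbrs G x \<longleftrightarrow> x \<in> nbrs G y"
  by (simp add: nbrs_def insert_commute)

lemma bipartite_nbrs:
  assumes "bipartite_graph G"
  shows "x \<in> left G \<Longrightarrow> nbrs G x \<subseteq> right G" "x \<in> right G \<Longrightarrow> nbrs G x \<subseteq> left G"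
  using assms by (auto simp: bipartite_graph_def nbrs_def doubleton_eq_iff dest!: subsetD)

lemma contains_induced_trans:
  assumes "contains_induced G G'" "contains_induced G' H"
  shows "contains_induced G H"
proof -
  obtain g where g: "inj_on g (verts G')"
    "g ` left G' \<subseteq> left G \<and> g ` right G' \<subseteq> right G \<or> g ` left G' \<subseteq> right G \<and> g ` right G' \<subseteq> left G"
    "\<forall>x\<in>verts G'. \<forall>y\<in>verts G'. {g x, g y} \<in> edges G \<longleftrightarrow> {x, y} \<in> edges G'"
    using assms(1) unfolding contains_induced_def by (elim exE conjE)
  obtain f where f: "inj_on f (verts H)"
    "f ` left H \<subseteq> left G' \<and> f ` right H \<subseteq> right G' \<or> f ` left H \<subseteq> right G' \<and> f ` right H \<subseteq> left G'"
    "\<forall>x\<in>verts H. \<forall>y\<in>verts H. {f x, f y} \<in> edges G' \<longleftrightarrow> {x, y} \<in> edges H"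
    using assms(2) unfolding contains_induced_def by (elim exE conjE)
  have fH: "f ` verts H \<subseteq> verts G'"
    using f(2) by (auto simp: verts_def)
  show ?thesis
    unfolding contains_induced_def
  proof (intro exI[of _ "g \<circ> f"] conjI ballI)
    show "inj_on (g \<circ> f) (verts H)"
      using f(1) g(1) fH by (auto intro: comp_inj_on inj_on_subset)
    show "(g \<circ> f) ` left H \<subseteq> left G \<and> (g \<circ> f) ` right H \<subseteq> right G \<or>
        (g \<circ> f) ` left H \<subseteq> right G \<and> (g \<circ> f) ` right H \<subseteq> left G"
      using f(2) g(2) unfolding image_subset_iff comp_def by (elim disjE conjE) simp_all
    show "{(g \<circ> f) x, (g \<circ> f) y} \<in> edges G \<longleftrightarrow> {x, y} \<in> edges H" if "x \<in> verts H" "y \<in> verts H" for x y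
    proof -
      have "f x \<in> verts G'" "f y \<in> verts G'"
        using fH that by blast+
      then show ?thesis
        using f(3) g(3) that by simp
    qed
  qed
qed

text \<open>It suffices to know the neighbours of the inner vertices \<open>v1\<close>, \<open>v3\<close>, \<open>v5\<close> on the other side.
  The two possible sides for \<open>L\<close> correspond to the two kinds of paths in \<open>path_free\<close>.\<close>
lemma contains_P7:
  fixes G :: "'a bigraph"
  assumes G: "bipartite_graph G"
    and side: "L = left G \<and> R = right G \<or> L = right G \<and> R = left G"
    and L: "v0 \<in> L" "v2 \<in> L" "v4 \<in> L" "v6 \<in> L" and R: "v1 \<in> R" "v3 \<in> R" "v5 \<in> R"
    and N1: "v0 \<in> nbrs G v1" "v2 \<in> nbrs G v1" "v4 \<notin> nbrs G v1" "v6 \<notin> nbrs G v1"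
    and N3: "v0 \<notin> nbrs G v3" "v2 \<in> nbrs G v3" "v4 \<in> nbrs G v3" "v6 \<notin> nbrs G v3"
    and N5: "v0 \<notin> nbrs G v5" "v2 \<notin> nbrs G v5" "v4 \<in> nbrs G v5" "v6 \<in> nbrs G v5"
  shows "contains_induced G (path_bigraph 7)"
proof -
  define f where "f = (\<lambda>i. [v0, v1, v2, v3, v4, v5, v6] ! i)"
  have f: "f 0 = v0" "f (Suc 0) = v1" "f 2 = v2" "f 3 = v3" "f 4 = v4" "f 5 = v5" "f 6 = v6"
    by (simp_all add: f_def)
  have disj: "L \<inter> R = {}"
    using G side by (auto simp: bipartite_graph_def)
  have indep: "{x, y} \<notin> edges G" if "x \<in> L \<and> y \<in> L \<or> x \<in> R \<and> y \<in> R" for x y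
    using bipartite_nbrs[OF G, of x] that side disj by (auto simp: nbrs_def)
  have nonedges: "{v0, v2} \<notin> edges G" "{v0, v4} \<notin> edges G" "{v0, v6} \<notin> edges G"
    "{v2, v4} \<notin> edges G" "{v2, v6} \<notin> edges G" "{v4, v6} \<notin> edges G"
    "{v1, v3} \<notin> edges G" "{v1, v5} \<notin> edges G" "{v3, v5} \<notin> edges G"
    by (rule indep, use L R in simp)+
  have singles: "{x} \<notin> edges G" for x
  proof
    assume "{x} \<in> edges G"
    then obtain y z where "{x} = {y, z}" "y \<in> left G" "z \<in> right G"
      using G by (auto simp: bipartite_graph_def)
    then show False
      using G by (auto simp: bipartite_graph_def)
  qed
  have cross: "{v0, v1} \<in> edges G" "{v1, v2} \<in> edges G" "{v1, v4} \<notin> edges G" "{v1, v6} \<notin> edges G"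
    "{v0, v3} \<notin> edges G" "{v2, v3} \<in> edges G" "{v3, v4} \<in> edges G" "{v3, v6} \<notin> edges G"
    "{v0, v5} \<notin> edges G" "{v2, v5} \<notin> edges G" "{v4, v5} \<in> edges G" "{v5, v6} \<in> edges G"
    using N1 N3 N5 by (simp_all add: nbrs_def insert_commute)
  have less7: "i < 7 \<longleftrightarrow> i = 0 \<or> i = 1 \<or> i = 2 \<or> i = 3 \<or> i = 4 \<or> i = 5 \<or> i = 6" for i :: nat
    by (auto simp: less_Suc_eq numeral_eq_Suc)
  have lt7: "{i. i < 7 \<and> even i} = {0, 2, 4, 6::nat}" "{i. i < 7 \<and> odd i} = {1, 3, 5::nat}"
    by (auto simp: less7)
  have "{i. Suc i < 7} = {0, 1, 2, 3, 4, 5}"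
    by (auto simp: less_Suc_eq numeral_eq_Suc)
  then have edges7: "edges (path_bigraph 7) = {{0, 1}, {1, 2}, {2, 3}, {3, 4}, {4, 5}, {5, 6}}"
    unfolding path_bigraph_def by (simp add: setcompr_eq_image eval_nat_numeral)
  have V: "verts (path_bigraph 7) = {0, 1, 2, 3, 4, 5, 6}"
    unfolding verts_def by (auto simp: path_bigraph_def lt7)
  \<comment> \<open>by symmetry, only pairs of indices in increasing order have to be checked\<close>
  define P where "P x y \<longleftrightarrow> {f x, f y} \<in> edges G \<longleftrightarrow> {x, y} \<in> edges (path_bigraph 7)" for x y
  have P_sym: "P x y \<longleftrightarrow> P y x" for x y
    by (simp add: P_def insert_commute)
  have P_refl: "P x x" if "x \<in> {0, 1, 2, 3, 4, 5, 6}" for x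
    using that by (auto simp: P_def singles edges7)
  have "P 0 1" "P 0 2" "P 0 3" "P 0 4" "P 0 5" "P 0 6" "P 1 2" "P 1 3" "P 1 4" "P 1 5" "P 1 6"
    "P 2 3" "P 2 4" "P 2 5" "P 2 6" "P 3 4" "P 3 5" "P 3 6" "P 4 5" "P 4 6" "P 5 6"
    by (simp_all add: P_def f edges7 doubleton_eq_iff nonedges cross)
  note Ps = this this[THEN P_sym[THEN iffD1]]
  have P: "P x y" if "x \<in> {0, 1, 2, 3, 4, 5, 6}" "y \<in> {0, 1, 2, 3, 4, 5, 6}" for x y
    using that by (elim insertE emptyE; hypsubst) (rule Ps P_refl; simp)+
  show ?thesis
    unfolding contains_induced_def
  proof (intro exI[of _ f] conjI)
    have LR: "x \<noteq> y" "y \<noteq> x" if "x \<in> L" "y \<in> R" for x y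
      using disj that by blast+
    have "v0 \<noteq> v2" "v0 \<noteq> v4" "v0 \<noteq> v6" "v2 \<noteq> v4" "v2 \<noteq> v6" "v4 \<noteq> v6" "v1 \<noteq> v3" "v1 \<noteq> v5" "v3 \<noteq> v5"
      using N1 N3 N5 by blast+
    then have "distinct [v0, v1, v2, v3, v4, v5, v6]"
      using L R LR by simp
    then show "inj_on f (verts (path_bigraph 7))"
      unfolding V by (auto simp: f inj_on_def)
    show "f ` left (path_bigraph 7) \<subseteq> left G \<and> f ` right (path_bigraph 7) \<subseteq> right G \<or>
        f ` left (path_bigraph 7) \<subseteq> right G \<and> f ` right (path_bigraph 7) \<subseteq> left G"
      using side L R by (auto simp: path_bigraph_def lt7 f)
    show "\<forall>x\<in>verts (path_bigraph 7). \<forall>y\<in>verts (path_bigraph 7).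
        {f x, f y} \<in> edges G \<longleftrightarrow> {x, y} \<in> edges (path_bigraph 7)"
      using P unfolding V P_def by blast
  qed
qed

lemma path_free_nbrs:
  assumes G: "bipartite_graph G" and free: "\<not> contains_induced G (path_bigraph 7)"
    and side: "L = left G \<and> R = right G \<or> L = right G \<and> R = left G"
  shows "path_free (nbrs G ` L)"
proof -
  have sub: "nbrs G x \<subseteq> R" if "x \<in> L" for x
    using bipartite_nbrs[OF G] side that by auto
  have side': "R = left G \<and> L = right G \<or> R = right G \<and> L = left G"
    using side by auto
  show ?thesis
    unfolding path_free_def
  proof (intro conjI ballI allI notI, goal_cases)
    case (1 X Y Z a b c d)
    then obtain x y z where "x \<in> L" "y \<in> L" "z \<in> L" "X = nbrs G x" "Y = nbrs G y" "Z = nbrs G z"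
      by blast
    note xyz = this
    have abcd: "a \<in> R" "b \<in> R" "c \<in> R" "d \<in> R"
      using 1(4) xyz sub by blast+
    have "contains_induced G (path_bigraph 7)"
      by (rule contains_P7[OF G side' abcd xyz(1-3)]) (use 1(4) xyz(4-6) in simp_all)
    with free show False
      by contradiction
  next
    case (2 W X Y Z a b c)
    then obtain w x y z where "w \<in> L" "x \<in> L" "y \<in> L" "z \<in> L"
      "W = nbrs G w" "X = nbrs G x" "Y = nbrs G y" "Z = nbrs G z"
      by blast
    note wxyz = this
    have abc: "a \<in> R" "b \<in> R" "c \<in> R"
      using 2(5) wxyz sub by blast+
    have "contains_induced G (path_bigraph 7)"
      by (rule contains_P7[OF G side wxyz(1-4) abc])
        (use 2(5) wxyz(5-8) in \<open>simp_all add: nbrs_sym[of w] nbrs_sym[of x] nbrs_sym[of y] nbrs_sym[of z]\<close>)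
    with free show False
      by contradiction
  qed
qed

lemma close_vertices:
  assumes G: "bipartite_graph G" and free: "\<not> contains_induced G (path_bigraph 7)"
    and card: "3 \<le> card (verts G)"
  shows "\<exists>x y. x \<noteq> y \<and> (x \<in> left G \<and> y \<in> left G \<or> x \<in> right G \<and> y \<in> right G) \<and>
    card ((nbrs G x - nbrs G y) \<union> (nbrs G y - nbrs G x)) \<le> 400"
proof -
  have fin: "finite (left G)" "finite (right G)"
    using G by (auto simp: bipartite_graph_def)
  have sum: "3 \<le> card (left G) + card (right G)"
    using card card_Un_le[of "left G" "right G"] by (simp add: verts_def)
  show ?thesis
  proof (cases "card (right G) \<le> card (left G)")
    case True
    have "\<exists>x\<in>left G. \<exists>y\<in>left G. x \<noteq> y \<and> card ((nbrs G x - nbrs G y) \<union> (nbrs G y - nbrs G x)) \<le> 400"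
    proof (rule close_pair[OF fin])
      show "nbrs G ` left G \<subseteq> Pow (right G)"
        using bipartite_nbrs(1)[OF G] by blast
    qed (use True sum path_free_nbrs[OF G free] in auto)
    then show ?thesis
      by blast
  next
    case False
    have "\<exists>x\<in>right G. \<exists>y\<in>right G. x \<noteq> y \<and> card ((nbrs G x - nbrs G y) \<union> (nbrs G y - nbrs G x)) \<le> 400"
    proof (rule close_pair[OF fin(2,1)])
      show "nbrs G ` right G \<subseteq> Pow (left G)"
        using bipartite_nbrs(2)[OF G] by blast
    qed (use False sum path_free_nbrs[OF G free] in auto)
    then show ?thesis
      by blast
  qed
qed

section \<open>Counting\<close>

definition remove_vertex :: "'a bigraph \<Rightarrow> 'a \<Rightarrow> 'a bigraph" where
  "remove_vertex G x =
     \<lparr>left = left G - {x}, right = right G - {x}, edges = {e \<in> edges G. x \<notin> e}\<rparr>"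

text \<open>The inverse of \<open>remove_vertex\<close>: the new vertex \<open>x\<close> joins the side of \<open>y\<close>, and its neighbourhood is
  that of \<open>y\<close> changed on \<open>D\<close>.\<close>
definition attach_vertex :: "'a \<Rightarrow> 'a \<Rightarrow> 'a set \<Rightarrow> 'a bigraph \<Rightarrow> 'a bigraph" where
  "attach_vertex x y D G =
     \<lparr>left = (if y \<in> left G then insert x (left G) else left G),
      right = (if y \<in> left G then right G else insert x (right G)),
      edges = edges G \<union> (\<lambda>z. {x, z}) ` ((nbrs G y - D) \<union> (D - nbrs G y))\<rparr>"

lemma remove_vertex_bipartite:
  assumes "bipartite_graph G"
  shows "bipartite_graph (remove_vertex G x)"
proof -
  have "edges (remove_vertex G x)
      \<subseteq> {{u, v} | u v. u \<in> left (remove_vertex G x) \<and> v \<in> right (remove_vertex G x)}"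
  proof
    fix e
    assume "e \<in> edges (remove_vertex G x)"
    then have "e \<in> edges G" "x \<notin> e"
      by (auto simp: remove_vertex_def)
    then obtain u v where "e = {u, v}" "u \<in> left G" "v \<in> right G"
      using assms unfolding bipartite_graph_def by blast
    with \<open>x \<notin> e\<close> show "e \<in> {{u, v} | u v. u \<in> left (remove_vertex G x) \<and> v \<in> right (remove_vertex G x)}"
      by (auto simp: remove_vertex_def)
  qed
  then show ?thesis
    using assms unfolding bipartite_graph_def by (auto simp: remove_vertex_def)
qed

lemma verts_remove_vertex: "verts (remove_vertex G x) = verts G - {x}"
  by (auto simp: verts_def remove_vertex_def)

lemma contains_remove_vertex: "contains_induced G (remove_vertex G x)"
  unfolding contains_induced_def
  by (rule exI[of _ "\<lambda>v. v"]) (auto simp: remove_vertex_def verts_def)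

lemma attach_remove_vertex:
  assumes G: "bipartite_graph G" and "x \<noteq> y"
    and side: "x \<in> left G \<and> y \<in> left G \<or> x \<in> right G \<and> y \<in> right G"
  shows "attach_vertex x y ((nbrs G x - nbrs G y) \<union> (nbrs G y - nbrs G x)) (remove_vertex G x) = G"
proof -
  have disj: "left G \<inter> right G = {}"
    using G by (simp add: bipartite_graph_def)
  have "x \<notin> nbrs G y"
    using bipartite_nbrs[OF G, of y] side disj by blast
  then have N: "nbrs (remove_vertex G x) y = nbrs G y"
    using \<open>x \<noteq> y\<close> by (auto simp: nbrs_def remove_vertex_def)
  have "(nbrs G y - ((nbrs G x - nbrs G y) \<union> (nbrs G y - nbrs G x))) \<union>
      (((nbrs G x - nbrs G y) \<union> (nbrs G y - nbrs G x)) - nbrs G y) = nbrs G x"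
    by blast
  moreover have "{e \<in> edges G. x \<notin> e} \<union> (\<lambda>z. {x, z}) ` nbrs G x = edges G"
  proof
    show "edges G \<subseteq> {e \<in> edges G. x \<notin> e} \<union> (\<lambda>z. {x, z}) ` nbrs G x"
    proof
      fix e
      assume e: "e \<in> edges G"
      then obtain u v where uv: "e = {u, v}"
        using G unfolding bipartite_graph_def by blast
      then consider "x \<notin> e" | "e = {x, v}" | "e = {x, u}"
        by blast
      then show "e \<in> {e \<in> edges G. x \<notin> e} \<union> (\<lambda>z. {x, z}) ` nbrs G x"
        using e by cases (auto simp: nbrs_def)
    qed
  qed (auto simp: nbrs_def)
  ultimately have "edges (attach_vertex x y ((nbrs G x - nbrs G y) \<union> (nbrs G y - nbrs G x)) (remove_vertex G x))
      = edges G"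
    unfolding attach_vertex_def N by (simp add: remove_vertex_def)
  moreover have "left (attach_vertex x y D (remove_vertex G x)) = left G"
    "right (attach_vertex x y D (remove_vertex G x)) = right G" for D
    using side disj \<open>x \<noteq> y\<close> by (auto simp: attach_vertex_def remove_vertex_def)
  ultimately show ?thesis
    by (intro bigraph.equality) simp_all
qed

lemma card_subsets_of_bounded_card:
  assumes "finite V"
  shows "card {D. D \<subseteq> V \<and> card D \<le> k} \<le> (card V + 1) ^ k"
proof (induction k)
  case 0
  have "{D. D \<subseteq> V \<and> card D \<le> 0} = {{}}"
    using finite_subset[OF _ assms] by auto
  then show ?case
    by simp
next
  case (Suc k)
  let ?S = "{D. D \<subseteq> V \<and> card D \<le> k}"
  have fin: "finite ?S"
    using assms by simp
  have "{D. D \<subseteq> V \<and> card D \<le> Suc k} \<subseteq> ?S \<union> (\<lambda>(v, D). insert v D) ` (V \<times> ?S)"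
  proof
    fix D
    assume "D \<in> {D. D \<subseteq> V \<and> card D \<le> Suc k}"
    then have D: "D \<subseteq> V" "card D \<le> Suc k"
      by auto
    show "D \<in> ?S \<union> (\<lambda>(v, D). insert v D) ` (V \<times> ?S)"
    proof (cases "D = {}")
      case False
      then obtain v where v: "v \<in> D"
        by blast
      then have "card (D - {v}) \<le> k"
        using D finite_subset[OF D(1) assms] by (simp add: card_Diff_singleton)
      then have "(v, D - {v}) \<in> V \<times> ?S" "D = (\<lambda>(v, D). insert v D) (v, D - {v})"
        using v D(1) by auto
      then show ?thesis
        by blast
    qed simp
  qed
  then have "card {D. D \<subseteq> V \<and> card D \<le> Suc k} \<le> card (?S \<union> (\<lambda>(v, D). insert v D) ` (V \<times> ?S))"
    using fin assms by (intro card_mono) auto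
  also have "\<dots> \<le> card ?S + card ((\<lambda>(v, D). insert v D) ` (V \<times> ?S))"
    by (rule card_Un_le)
  also have "\<dots> \<le> card ?S + card V * card ?S"
    using card_image_le[of "V \<times> ?S" "\<lambda>(v, D). insert v D"] fin assms by (simp add: card_cartesian_product)
  also have "\<dots> = (card V + 1) * card ?S"
    by simp
  also have "\<dots> \<le> (card V + 1) * (card V + 1) ^ k"
    using Suc.IH by (rule mult_le_mono2)
  finally show ?case
    by simp
qed

definition P7_free_graphs :: "'a set \<Rightarrow> 'a bigraph set" where
  "P7_free_graphs V =
     {G. bipartite_graph G \<and> \<not> contains_induced G (path_bigraph 7) \<and> verts G = V}"

lemma P7_free_graphs_subset:
  "P7_free_graphs V \<subseteq> (\<lambda>(l, r, e). \<lparr>left = l, right = r, edges = e\<rparr>) ` (Pow V \<times> Pow V \<times> Pow (Pow V))"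
proof
  fix G
  assume G: "G \<in> P7_free_graphs V"
  have "edges G \<subseteq> Pow V"
  proof
    fix e
    assume "e \<in> edges G"
    then obtain u v where "e = {u, v}" "u \<in> left G" "v \<in> right G"
      using G unfolding P7_free_graphs_def bipartite_graph_def by blast
    then show "e \<in> Pow V"
      using G by (auto simp: P7_free_graphs_def verts_def)
  qed
  then have "(left G, right G, edges G) \<in> Pow V \<times> Pow V \<times> Pow (Pow V)"
    using G by (auto simp: P7_free_graphs_def verts_def)
  then show "G \<in> (\<lambda>(l, r, e). \<lparr>left = l, right = r, edges = e\<rparr>) ` (Pow V \<times> Pow V \<times> Pow (Pow V))"
    by (rule rev_image_eqI) simp
qed

lemma finite_P7_free_graphs: "finite V \<Longrightarrow> finite (P7_free_graphs V)"
  by (rule finite_subset[OF P7_free_graphs_subset]) simp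

text \<open>There are at most \<open>n\<close> choices for each of the two close vertices and \<open>(n + 1)\<^bsup>400\<^esup>\<close> for the
  difference, which explains the exponent 402. On two vertices there are at most
  \<open>4 * 4 * 16 = 256\<close> choices of two parts and a set of edges.\<close>
lemma card_P7_free_graphs_le:
  assumes "finite V"
  shows "card (P7_free_graphs V) \<le> 256 * (card V + 1) ^ (402 * card V)"
  using assms
proof (induction "card V" arbitrary: V rule: less_induct)
  case less
  let ?n = "card V"
  note fin = \<open>finite V\<close>
  show ?case
  proof (cases "?n \<le> 2")
    case True
    have "card (P7_free_graphs V) \<le> card (Pow V \<times> Pow V \<times> Pow (Pow V))"
      using fin by (intro surj_card_le[OF _ P7_free_graphs_subset]) simp
    also have "\<dots> = 2 ^ ?n * (2 ^ ?n * 2 ^ (2 ^ ?n))"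
      using fin by (simp add: card_cartesian_product card_Pow)
    also have "\<dots> \<le> 2 ^ 2 * (2 ^ 2 * 2 ^ (2 ^ 2))"
      using True by (intro mult_le_mono power_increasing) auto
    also have "\<dots> \<le> 256 * (?n + 1) ^ (402 * ?n)"
      by simp
    finally show ?thesis .
  next
    case False
    define D where "D = {D. D \<subseteq> V \<and> card D \<le> 400}"
    have finD: "finite D"
      using fin by (simp add: D_def)
    have "P7_free_graphs V \<subseteq> (\<lambda>(x, y, D, G). attach_vertex x y D G) `
        (SIGMA x:V. V \<times> D \<times> P7_free_graphs (V - {x}))"
    proof
      fix G :: "'a bigraph"
      assume "G \<in> P7_free_graphs V"
      then have G: "bipartite_graph G" "\<not> contains_induced G (path_bigraph 7)" "verts G = V"
        by (auto simp: P7_free_graphs_def)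
      obtain x y where xy: "x \<noteq> y" "x \<in> left G \<and> y \<in> left G \<or> x \<in> right G \<and> y \<in> right G"
        and close: "card ((nbrs G x - nbrs G y) \<union> (nbrs G y - nbrs G x)) \<le> 400"
        using close_vertices[OF G(1,2)] False G(3) by auto
      let ?D = "(nbrs G x - nbrs G y) \<union> (nbrs G y - nbrs G x)"
      have V: "x \<in> V" "y \<in> V" "?D \<in> D"
        using xy(2) close G(3) bipartite_nbrs[OF G(1)] by (auto simp: D_def verts_def)
      have "remove_vertex G x \<in> P7_free_graphs (V - {x})"
        using G remove_vertex_bipartite contains_induced_trans[OF contains_remove_vertex, of G x "path_bigraph 7"]
        unfolding P7_free_graphs_def by (auto simp: verts_remove_vertex)
      with V have "(x, y, ?D, remove_vertex G x) \<in> (SIGMA x:V. V \<times> D \<times> P7_free_graphs (V - {x}))"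
        by blast
      then show "G \<in> (\<lambda>(x, y, D, G). attach_vertex x y D G) `
          (SIGMA x:V. V \<times> D \<times> P7_free_graphs (V - {x}))"
        by (rule rev_image_eqI) (simp add: attach_remove_vertex[OF G(1) xy])
    qed
    then have "card (P7_free_graphs V) \<le> card (SIGMA x:V. V \<times> D \<times> P7_free_graphs (V - {x}))"
      using fin finD finite_P7_free_graphs
      by (intro surj_card_le finite_SigmaI finite_cartesian_product) auto
    also have "\<dots> = (\<Sum>x\<in>V. ?n * (card D * card (P7_free_graphs (V - {x}))))"
      using fin finD finite_P7_free_graphs by (subst card_SigmaI) (auto simp: card_cartesian_product)
    also have "\<dots> \<le> (\<Sum>x\<in>V. (?n + 1) * ((?n + 1) ^ 400 * (256 * (?n + 1) ^ (402 * (?n - 1)))))"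
    proof (rule sum_mono)
      fix x
      assume x: "x \<in> V"
      then have n: "card (V - {x}) = ?n - 1" "?n - 1 < ?n"
        using False fin by (auto simp: card_Diff_singleton)
      have "card (P7_free_graphs (V - {x})) \<le> 256 * (?n - 1 + 1) ^ (402 * (?n - 1))"
        using less.hyps[of "V - {x}"] n fin by simp
      also have "\<dots> \<le> 256 * (?n + 1) ^ (402 * (?n - 1))"
        by (intro mult_le_mono2 power_mono) auto
      finally have "card (P7_free_graphs (V - {x})) \<le> 256 * (?n + 1) ^ (402 * (?n - 1))" .
      moreover have "card D \<le> (?n + 1) ^ 400"
        unfolding D_def by (rule card_subsets_of_bounded_card[OF fin])
      ultimately show "?n * (card D * card (P7_free_graphs (V - {x})))
          \<le> (?n + 1) * ((?n + 1) ^ 400 * (256 * (?n + 1) ^ (402 * (?n - 1))))"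
        by (intro mult_le_mono) auto
    qed
    also have "\<dots> \<le> (?n + 1) * ((?n + 1) * ((?n + 1) ^ 400 * (256 * (?n + 1) ^ (402 * (?n - 1)))))"
      by simp
    also have "\<dots> = 256 * ((?n + 1) ^ 402 * (?n + 1) ^ (402 * (?n - 1)))"
    proof -
      have "(?n + 1) ^ 402 = (?n + 1) * ((?n + 1) * (?n + 1) ^ 400)"
        by (simp only: power_Suc[symmetric]) simp
      then show ?thesis
        by (simp only: mult_ac)
    qed
    also have "(?n + 1) ^ 402 * (?n + 1) ^ (402 * (?n - 1)) = (?n + 1) ^ (402 * ?n)"
    proof -
      have "402 + 402 * (?n - 1) = 402 * ?n"
        using False by simp
      then show ?thesis
        by (simp only: power_add[symmetric])
    qed
    finally show ?thesis .
  qed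
qed

lemma hereditary_P7_H_free_class: "hereditary (P7_H_free_class H :: 'a bigraph set)"
  unfolding hereditary_def P7_H_free_class_def
proof (intro conjI ballI allI impI)
  fix G G' :: "'a bigraph"
  assume "G \<in> {G. bipartite_graph G \<and> \<not> contains_induced G (path_bigraph 7) \<and> \<not> contains_induced G H}"
    and "bipartite_graph G' \<and> contains_induced G G'"
  then show "G' \<in> {G. bipartite_graph G \<and> \<not> contains_induced G (path_bigraph 7) \<and> \<not> contains_induced G H}"
    using contains_induced_trans[of G G' "path_bigraph 7"] contains_induced_trans[of G G' H] by blast
qed blast

theorem mainTheorem16:
  fixes H :: "'a bigraph"
  assumes "bipartite_graph H" and "card (verts H) \<le> 6"
  shows "at_most_factorial (P7_H_free_class H)"
proof -
  define g :: "nat \<Rightarrow> real" where "g n = 8 + 402 * real n * log 2 (real n + 1)" for n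
  have "g \<in> O(\<lambda>n. real n * ln (real n))"
  proof (rule landau_o.bigI[of "8 + 804 / ln 2"])
    show "\<forall>\<^sub>F n in sequentially. norm (g n) \<le> (8 + 804 / ln 2) * norm (real n * ln (real n))"
    proof (rule eventually_mono[OF eventually_ge_at_top[of 3]])
      fix n :: nat
      assume n: "3 \<le> n"
      have "ln (real n + 1) \<le> ln (real n ^ 2)"
      proof -
        have "3 * n \<le> n ^ 2"
          using mult_le_mono1[OF n, of n] by (simp only: power2_eq_square)
        then have "n + 1 \<le> n ^ 2"
          using n by linarith
        then have "real n + 1 \<le> real n ^ 2"
          by (metis of_nat_1 of_nat_add of_nat_le_iff of_nat_power)
        then show ?thesis
          using n by simp
      qed
      then have ln2: "ln (real n + 1) \<le> 2 * ln (real n)"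
        using n by (simp add: ln_realpow)
      have "1 \<le> ln (real n)"
        using n exp_le by (simp add: ln_ge_iff)
      then have one: "1 \<le> real n * ln (real n)"
        using n mult_mono[of 1 "real n" 1 "ln (real n)"] by simp
      have "real n * log 2 (real n + 1) \<le> 2 / ln 2 * (real n * ln (real n))"
        using mult_left_mono[OF ln2, of "real n / ln 2"] by (simp add: log_def field_simps)
      moreover have "(8 + 804 / ln 2) * (real n * ln (real n))
          = 8 * (real n * ln (real n)) + 402 * (2 / ln 2 * (real n * ln (real n)))"
        by (simp add: algebra_simps)
      ultimately have "g n \<le> (8 + 804 / ln 2) * (real n * ln (real n))"
        using one unfolding g_def by (simp only: mult.assoc)
      moreover have "0 \<le> g n"
        by (simp add: g_def)
      ultimately show "norm (g n) \<le> (8 + 804 / ln 2) * norm (real n * ln (real n))"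
        using one by simp
    qed
  qed (simp add: add_pos_pos)
  moreover have "real (labelled_count (P7_H_free_class H) n) \<le> 2 powr g n" for n
  proof -
    have "{G \<in> P7_H_free_class H. verts G = {1..n}} \<subseteq> P7_free_graphs {1..n}"
      by (auto simp: P7_H_free_class_def P7_free_graphs_def)
    then have "labelled_count (P7_H_free_class H) n \<le> card (P7_free_graphs {1..n})"
      unfolding labelled_count_def by (intro card_mono finite_P7_free_graphs) auto
    also have "\<dots> \<le> 256 * (n + 1) ^ (402 * n)"
      using card_P7_free_graphs_le[of "{1..n}"] by simp
    finally have "real (labelled_count (P7_H_free_class H) n) \<le> real (256 * (n + 1) ^ (402 * n))"
      by (rule of_nat_mono)
    also have "\<dots> = 2 powr 8 * (real n + 1) powr real (402 * n)"
    proof -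
      have "(real n + 1) powr real (402 * n) = (real n + 1) ^ (402 * n)"
        by (rule powr_realpow) simp
      then show ?thesis
        by (simp only:) (simp add: add.commute)
    qed
    also have "(real n + 1) powr real (402 * n) = 2 powr (log 2 (real n + 1) * real (402 * n))"
      unfolding powr_powr[symmetric] by simp
    also have "2 powr 8 * \<dots> = 2 powr (8 + log 2 (real n + 1) * real (402 * n))"
      by (rule powr_add[symmetric])
    also have "8 + log 2 (real n + 1) * real (402 * n) = g n"
      by (simp add: g_def)
    finally show ?thesis .
  qed
  ultimately show ?thesis
    unfolding at_most_factorial_def using hereditary_P7_H_free_class by blast
qed

end
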